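(* Let $\{X_i, i\ge 1\}$ be independent and identically distributed random variables with $P\{X_1=0\}=P\{X_1=1\}=\frac12$, and let $M_N$ be the number of switches of the longest run of consecutive switches in $(X_1,\dots,X_N)$. Let $\{\gamma_n\}_{n\ge1}$ be a sequence of positive numbers for which $\sum_{n=1}^{\infty}2^{-\gamma_n}=\infty$. Then for almost all $\omega\in\Omega$ there exists an infinite sequence $N_i=N_i(\omega,\{\gamma_n\})$ $(i=1,2,\dots)$ of (distinct) integers such that $$M_{N_i}\ge\gamma_{N_i}-1.$$
   Context: All random variables are defined on a probability space $(\Omega,\mathcal F,P)$. For integers $m,n\ge 1$ let $$S_n^{(m)}=\sum_{i=m+1}^{n+m-1}(1-X_{i-1})X_i+\sum_{i=m+1}^{n+m-1}X_{i-1}(1-X_i),$$ which is the total number of switches (indices $i$ with $X_{i-1}\neq X_i$) in the block $(X_m,\dots,X_{m+n-1})$ (an empty sum is $0$, so $S_1^{(m)}=0$). For integers $i,N\ge 1$ and $1\le n\le N$ let $H_{n,i}^{(N)}=\bigcup_{i\le m\le i+N-n}\{S_n^{(m)}=n-1\}$, the event that some block of $n$ consecutive terms of $(X_i,\dots,X_{i+N-1})$ consists entirely of switches. Define the random variable $M_N^{(i)}(\omega)=\max\{n-1: 1\le n\le N,\ \omega\in H_{n,i}^{(N)}\}$ and $M_N=M_N^{(1)}$. *)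

theory Defs
  imports "HOL-Probability.Probability"
begin

(* S_n^(m): the number of switches in the block X_m, ..., X_(m+n-1).  The second sum counts
   switches from 1 to 0, the first one switches from 0 to 1; both are empty for n = 1. *)
definition switch_count :: "(nat \<Rightarrow> 'a \<Rightarrow> real) \<Rightarrow> nat \<Rightarrow> nat \<Rightarrow> 'a \<Rightarrow> real" where
  "switch_count X m n \<omega> =
     (\<Sum>i = m + 1..n + m - 1. (1 - X (i - 1) \<omega>) * X i \<omega>) +
     (\<Sum>i = m + 1..n + m - 1. X (i - 1) \<omega> * (1 - X i \<omega>))"

(* H_(n,i)^(N), to be used for 1 \<le> n \<le> N, where the truncated subtraction is exact. *)
definition run_event :: "'a measure \<Rightarrow> (nat \<Rightarrow> 'a \<Rightarrow> real) \<Rightarrow> nat \<Rightarrow> nat \<Rightarrow> nat \<Rightarrow> 'a set" where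
  "run_event P X n i N =
     (\<Union>m\<in>{i..i + N - n}. {\<omega> \<in> space P. switch_count X m n \<omega> = real n - 1})"

(* M_N^(i).  For N \<ge> 1 and \<omega> in the sample space the set contains 0 (take n = 1), so the
   maximum exists; it is unspecified for N = 0. *)
definition longest_run :: "'a measure \<Rightarrow> (nat \<Rightarrow> 'a \<Rightarrow> real) \<Rightarrow> nat \<Rightarrow> nat \<Rightarrow> 'a \<Rightarrow> nat" where
  "longest_run P X i N \<omega> = Max {n - 1 | n. 1 \<le> n \<and> n \<le> N \<and> \<omega> \<in> run_event P X n i N}"

end

theory Submission
  imports Defs
begin

text \<open>
  Let \<open>k N = \<lceil>\<gamma> N - 1\<rceil>\<close>. It suffices to find infinitely many \<open>N\<close> for which the last \<open>k N\<close> steps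
  up to index \<open>N\<close> are all switches. Ask in addition that this run starts right after a non-switch at
  index \<open>s = N - k N\<close>, and among the \<open>N\<close> with the same \<open>s\<close> keep only the smallest one; since
  these \<open>N\<close> have distinct \<open>k N\<close>, a geometric series shows that this costs at most a factor 2 in the sum
  of the probabilities, which therefore still diverges. The switch indicators are independent fair bits, and events
  belonging to different starting points \<open>s\<close> are either independent or, when their index ranges
  overlap, disjoint. So they are pairwise nonpositively correlated, and the second moment version
  of the Borel--Cantelli lemma applies.
\<close>

section \<open>Second moment version of the Borel--Cantelli lemma\<close>

text \<open>Expanding the squared sum, the off-diagonal terms are at most the matching terms of the
  squared mean, while the diagonal terms, indicators being idempotent, add up to the mean
  itself.\<close>

lemma (in prob_space) variance_sum_indicators_le:
  fixes A :: "'b \<Rightarrow> 'a set"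
  assumes "finite I" and ev: "\<And>i. i \<in> I \<Longrightarrow> A i \<in> events"
    and corr: "\<And>i j. i \<in> I \<Longrightarrow> j \<in> I \<Longrightarrow> i \<noteq> j \<Longrightarrow> prob (A i \<inter> A j) \<le> prob (A i) * prob (A j)"
  shows "variance (\<lambda>x. \<Sum>i\<in>I. indicator (A i) x) \<le> (\<Sum>i\<in>I. prob (A i))"
proof -
  let ?S = "\<lambda>x. \<Sum>i\<in>I. indicator (A i) x :: real"
  let ?\<mu> = "\<Sum>i\<in>I. prob (A i)"
  have int: "integrable M (indicator (A i) :: 'a \<Rightarrow> real)" if "i \<in> I" for i
    using ev[OF that] by (simp add: emeasure_eq_measure)
  have int2: "integrable M (\<lambda>x. indicator (A i) x * indicator (A j) x :: real)"
    if "i \<in> I" "j \<in> I" for i j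
    using ev that by (auto simp flip: indicator_inter_arith simp: emeasure_eq_measure)
  have E2: "(\<integral>x. indicator (A i) x * indicator (A j) x \<partial>M) = prob (A i \<inter> A j)"
    if "i \<in> I" "j \<in> I" for i j
  proof -
    have "(\<integral>x. indicator (A i) x * indicator (A j) x \<partial>M :: real)
        = (\<integral>x. indicator (A i \<inter> A j) x \<partial>M)"
      by (simp only: indicator_inter_arith)
    also have "\<dots> = prob (A i \<inter> A j)"
      using ev that by (simp add: Int_absorb2 sets.sets_into_space Int_assoc)
    finally show ?thesis .
  qed
  have sq: "(?S x)\<^sup>2 = (\<Sum>i\<in>I. \<Sum>j\<in>I. indicator (A i) x * indicator (A j) x)" for x
    by (simp add: power2_eq_square sum_product)
  have ES: "expectation ?S = ?\<mu>"
    using int ev by (simp add: Bochner_Integration.integral_sum)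
  have intS: "integrable M ?S" using int by auto
  have intS2: "integrable M (\<lambda>x. (?S x)\<^sup>2)"
    unfolding sq using int2 by auto
  have "expectation (\<lambda>x. (?S x)\<^sup>2) = (\<Sum>i\<in>I. \<Sum>j\<in>I. prob (A i \<inter> A j))"
    unfolding sq using int2 E2 by (simp add: Bochner_Integration.integral_sum)
  also have "\<dots> \<le> (\<Sum>i\<in>I. \<Sum>j\<in>I. prob (A i) * prob (A j) + (if i = j then prob (A i) else 0))"
    by (intro sum_mono) (auto intro: corr)
  also have "\<dots> = ?\<mu>\<^sup>2 + ?\<mu>"
    using \<open>finite I\<close> by (simp add: sum.distrib power2_eq_square sum_product)
  finally show ?thesis
    using variance_eq[OF intS intS2] ES by simp
qed

text \<open>If no event with index in \<open>{m..<n}\<close> occurs, their count deviates from its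
  mean \<open>?\<mu>\<close> by all of \<open>?\<mu>\<close>. By Chebyshev and the variance bound
  this has probability at most \<open>1 / ?\<mu>\<close>, and divergence makes \<open>?\<mu>\<close>
  as large as desired.\<close>

lemma (in prob_space) borel_cantelli_nonpos_correlated:
  fixes A :: "nat \<Rightarrow> 'a set"
  assumes ev: "\<And>i. A i \<in> events"
    and corr: "\<And>i j. i \<noteq> j \<Longrightarrow> prob (A i \<inter> A j) \<le> prob (A i) * prob (A j)"
    and div: "\<not> summable (\<lambda>i. prob (A i))"
  shows "AE x in M. \<exists>\<^sub>\<infinity>i. x \<in> A i"
proof -
  have null: "{x \<in> space M. \<forall>i\<ge>m. x \<notin> A i} \<in> null_sets M" for m
  proof -
    let ?N = "{x \<in> space M. \<forall>i\<ge>m. x \<notin> A i}"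
    have meas: "?N \<in> events" using ev by measurable
    have le: "prob ?N \<le> e" if "e > 0" for e :: real
    proof -
      have "\<exists>n. (\<Sum>i=m..<n. prob (A i)) > 1 / e"
      proof (rule ccontr)
        assume "\<nexists>n. (\<Sum>i=m..<n. prob (A i)) > 1 / e"
        then have le: "(\<Sum>i=m..<n. prob (A i)) \<le> 1 / e" for n by (meson not_less)
        have "summable (\<lambda>i. prob (A (i + m)))"
        proof (rule bounded_imp_summable)
          fix n
          show "(\<Sum>i\<le>n. prob (A (i + m))) \<le> 1 / e"
            using le[of "Suc n + m"] sum.shift_bounds_nat_ivl[of "\<lambda>i. prob (A i)" 0 m "Suc n"]
            by (simp add: atLeast0LessThan lessThan_Suc_atMost)
        qed simp
        with div summable_iff_shift[of "\<lambda>i. prob (A i)" m] show False by simp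
      qed
      then obtain n where n: "(\<Sum>i=m..<n. prob (A i)) > 1 / e" by blast
      let ?S = "\<lambda>x. \<Sum>i=m..<n. indicator (A i) x :: real"
      let ?\<mu> = "\<Sum>i=m..<n. prob (A i)"
      have \<mu>: "?\<mu> > 0" using n \<open>e > 0\<close> by (meson divide_pos_pos less_trans zero_less_one)
      have ES: "expectation ?S = ?\<mu>"
        using ev by (simp add: emeasure_eq_measure)
      have [measurable]: "?S \<in> borel_measurable M" using ev by measurable
      have bnd: "\<bar>?S x\<bar> \<le> real n" for x
      proof -
        have "?S x \<le> (\<Sum>i=m..<n. 1)" by (intro sum_mono) (simp add: indicator_def)
        moreover have "?S x \<ge> 0" by (intro sum_nonneg) simp
        ultimately show ?thesis by simp
      qed
      have "integrable M (\<lambda>x. (?S x)\<^sup>2)"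
        by (rule integrable_const_bound[where B = "(real n)\<^sup>2"])
           (use bnd in \<open>auto intro!: AE_I2 simp flip: abs_le_square_iff\<close>)
      then have "prob {x \<in> space M. ?\<mu> \<le> \<bar>?S x - expectation ?S\<bar>} \<le> variance ?S / ?\<mu>\<^sup>2"
        by (intro Chebyshev_inequality) (use \<mu> in auto)
      also have "\<dots> \<le> ?\<mu> / ?\<mu>\<^sup>2"
        using variance_sum_indicators_le[of "{m..<n}" A] ev corr
        by (intro divide_right_mono) auto
      also have "\<dots> = 1 / ?\<mu>" using \<mu> by (simp add: power2_eq_square)
      also have "\<dots> \<le> e" using n \<mu> \<open>e > 0\<close> by (simp add: field_simps)
      finally have "prob {x \<in> space M. ?\<mu> \<le> \<bar>?S x - expectation ?S\<bar>} \<le> e" .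
      moreover have "?N \<subseteq> {x \<in> space M. ?\<mu> \<le> \<bar>?S x - expectation ?S\<bar>}"
      proof clarify
        fix x assume "x \<in> space M" "\<forall>i\<ge>m. x \<notin> A i"
        then have "?S x = 0" by (intro sum.neutral) auto
        then show "?\<mu> \<le> \<bar>?S x - expectation ?S\<bar>" using \<mu> unfolding ES by simp
      qed
      then have "prob ?N \<le> prob {x \<in> space M. ?\<mu> \<le> \<bar>?S x - expectation ?S\<bar>}"
        by (intro finite_measure_mono) auto
      ultimately show ?thesis by linarith
    qed
    have "prob ?N \<le> 0" by (rule field_le_epsilon[where y = 0, unfolded add_0]) (rule le)
    then have "prob ?N = 0" by (simp only: measure_le_0_iff)
    with meas show ?thesis by (intro null_setsI) (simp_all only: emeasure_eq_measure ennreal_0)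
  qed
  \<comment> \<open>A point in only finitely many \<open>A i\<close> lies in the null set belonging
    to some \<open>m\<close>, and there are countably many \<open>m\<close>.\<close>
  have "AE x in M. \<forall>m. \<not> (\<forall>i\<ge>m. x \<notin> A i)"
    unfolding AE_all_countable
  proof
    fix m
    show "AE x in M. \<not> (\<forall>i\<ge>m. x \<notin> A i)"
      by (rule AE_I'[OF null[of m]]) blast
  qed
  then show ?thesis unfolding INFM_nat_le by eventually_elim blast
qed

section \<open>Joint law of the switch indicators\<close>

lemma switch_pattern_in_events:
  fixes Z :: "nat \<Rightarrow> 'a \<Rightarrow> bool"
  assumes Z: "\<And>i. i \<ge> 1 \<Longrightarrow> Z i \<in> measurable M (count_space UNIV)"
    and "finite I" and "I \<subseteq> {2..}"
  shows "{\<omega> \<in> space M. \<forall>i\<in>I. (Z (i - 1) \<omega> \<noteq> Z i \<omega>) = y i} \<in> sets M"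
  using \<open>finite I\<close>
proof (rule sets.sets_Collect_finite_All[rotated])
  fix i assume "i \<in> I"
  then have "2 \<le> i" using \<open>I \<subseteq> {2..}\<close> by auto
  then have [measurable]: "Z (i - 1) \<in> measurable M (count_space UNIV)"
    "Z i \<in> measurable M (count_space UNIV)" by (auto intro: Z)
  show "{\<omega> \<in> space M. (Z (i - 1) \<omega> \<noteq> Z i \<omega>) = y i} \<in> sets M" by measurable
qed

text \<open>Descending in \<open>n\<close> from \<open>Max I\<close>, this computes the law of the switch indicators from that of a
  finite block of bits by finite additivity alone.\<close>

lemma (in prob_space) prob_prefix_and_switch_pattern:
  fixes Z :: "nat \<Rightarrow> 'a \<Rightarrow> bool"
  assumes ind: "indep_vars (\<lambda>_. count_space UNIV) Z {1..}"
    and half: "\<And>i. i \<ge> 1 \<Longrightarrow> prob {\<omega> \<in> space M. Z i \<omega>} = 1 / 2"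
    and "I \<subseteq> {2..m}" and "n \<le> m"
  shows "prob {\<omega> \<in> space M. (\<forall>i\<in>{1..n}. Z i \<omega> = z i) \<and>
                 (\<forall>i\<in>I \<inter> {n<..}. (Z (i - 1) \<omega> \<noteq> Z i \<omega>) = y i)}
           = (1 / 2) ^ (n + card (I \<inter> {n<..}))"
  using \<open>n \<le> m\<close>
proof (induction n arbitrary: z rule: inc_induct)
  case base
  have [measurable]: "Z i \<in> measurable M (count_space UNIV)" if "i \<ge> 1" for i
    using ind that by (auto simp: indep_vars_def)
  have zi: "prob (Z i -` {z i} \<inter> space M) = 1 / 2" if "i \<ge> 1" for i
  proof -
    have "{\<omega> \<in> space M. Z i \<omega>} \<in> events" using that by measurable
    from prob_compl[OF this] half[OF that]
    have "prob (space M - {\<omega> \<in> space M. Z i \<omega>}) = 1 / 2" by simp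
    moreover have "space M - {\<omega> \<in> space M. Z i \<omega>} = Z i -` {False} \<inter> space M"
      and "{\<omega> \<in> space M. Z i \<omega>} = Z i -` {True} \<inter> space M" by auto
    ultimately show ?thesis using half[OF that] by (cases "z i") auto
  qed
  have "I \<inter> {m<..} = {}" using \<open>I \<subseteq> {2..m}\<close> by auto
  moreover have "prob {\<omega> \<in> space M. \<forall>i\<in>{1..m}. Z i \<omega> = z i} = (1 / 2) ^ m"
  \<comment> \<open>For \<open>m = 0\<close> the intersection below would be \<open>UNIV\<close>
    instead of \<open>space M\<close>.\<close>
  proof (cases "m = 0")
    case True
    then show ?thesis by (simp add: prob_space)
  next
    case False
    have "{\<omega> \<in> space M. \<forall>i\<in>{1..m}. Z i \<omega> = z i} = (\<Inter>i\<in>{1..m}. Z i -` {z i} \<inter> space M)"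
      using False by auto
    also have "prob \<dots> = (\<Prod>i\<in>{1..m}. prob (Z i -` {z i} \<inter> space M))"
      using False by (intro indep_varsD[OF ind]) auto
    also have "\<dots> = (\<Prod>i\<in>{1..m}. 1 / 2)" by (intro prod.cong refl zi) auto
    finally show ?thesis by simp
  qed
  ultimately show ?case by simp
next
  case (step n)
  have Z[measurable]: "Z i \<in> measurable M (count_space UNIV)" if "i \<ge> 1" for i
    using ind that by (auto simp: indep_vars_def)
  let ?E = "\<lambda>n z. {\<omega> \<in> space M. (\<forall>i\<in>{1..n}. Z i \<omega> = z i) \<and>
                 (\<forall>i\<in>I \<inter> {n<..}. (Z (i - 1) \<omega> \<noteq> Z i \<omega>) = y i)}"
  have upto_Suc: "(\<forall>i\<in>{1..Suc n}. P i) \<longleftrightarrow> (\<forall>i\<in>{1..n}. P i) \<and> P (Suc n)" for P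
    using atLeastAtMostSuc_conv[of 1 n] by auto
  have fin: "finite I" using \<open>I \<subseteq> {2..m}\<close> finite_subset by blast
  show ?case
  proof (cases "Suc n \<in> I")
    case True
    \<comment> \<open>The bit at \<open>n\<close> is therefore prescribed, and the switch condition
      at \<open>Suc n\<close> forces the next bit. The prefix gains one bit and the pattern loses
      one index, so the exponent is unchanged.\<close>
    then have "n \<ge> 1" using \<open>I \<subseteq> {2..m}\<close> by auto
    have I: "I \<inter> {n<..} = insert (Suc n) (I \<inter> {Suc n<..})" using True by auto
    have "?E n z = ?E (Suc n) (z(Suc n := (z n \<noteq> y (Suc n))))"
      unfolding upto_Suc I using \<open>n \<ge> 1\<close> by auto
    moreover have "card (I \<inter> {n<..}) = Suc (card (I \<inter> {Suc n<..}))"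
      unfolding I using fin by simp
    ultimately show ?thesis using step.IH by simp
  next
    case False
    have "x = Suc n" if "x \<in> {n<..}" "x \<notin> {Suc n<..}" for x using that by auto
    with False have I: "I \<inter> {n<..} = I \<inter> {Suc n<..}" by fastforce
    \<comment> \<open>The bit at \<open>Suc n\<close> is free: both of its values are equally likely
      given the formula for \<open>Suc n\<close>, and the two halves add up to the claimed
      power.\<close>
    have un: "?E n z = ?E (Suc n) (z(Suc n := True)) \<union> ?E (Suc n) (z(Suc n := False))"
      unfolding upto_Suc I by auto
    have ev: "?E (Suc n) z' \<in> events" for z'
    proof (intro sets.sets_Collect_conj)
      show "{\<omega> \<in> space M. \<forall>i\<in>{1..Suc n}. Z i \<omega> = z' i} \<in> events"
        by (rule sets.sets_Collect_finite_All) auto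
      show "{\<omega> \<in> space M. \<forall>i\<in>I \<inter> {Suc n<..}. (Z (i - 1) \<omega> \<noteq> Z i \<omega>) = y i} \<in> events"
        by (rule switch_pattern_in_events) (use Z fin \<open>I \<subseteq> {2..m}\<close> in auto)
    qed
    have "prob (?E n z) = prob (?E (Suc n) (z(Suc n := True)))
                        + prob (?E (Suc n) (z(Suc n := False)))"
      unfolding un
    proof (intro finite_measure_Union ev)
      show "?E (Suc n) (z(Suc n := True)) \<inter> ?E (Suc n) (z(Suc n := False)) = {}"
        unfolding upto_Suc by auto
    qed
    then show ?thesis unfolding step.IH I by simp
  qed
qed

text \<open>The case of an empty prefix. As \<open>y\<close> is arbitrary, it expresses that the
  switch indicators from index 2 on are independent fair bits.\<close>

lemma (in prob_space) prob_switch_pattern: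
  fixes Z :: "nat \<Rightarrow> 'a \<Rightarrow> bool"
  assumes "indep_vars (\<lambda>_. count_space UNIV) Z {1..}"
    and "\<And>i. i \<ge> 1 \<Longrightarrow> prob {\<omega> \<in> space M. Z i \<omega>} = 1 / 2"
    and "finite I" and "I \<subseteq> {2..}"
  shows "prob {\<omega> \<in> space M. \<forall>i\<in>I. (Z (i - 1) \<omega> \<noteq> Z i \<omega>) = y i} = (1 / 2) ^ card I"
proof -
  \<comment> \<open>Inserting 0 keeps \<open>Max\<close> meaningful when \<open>I\<close> is
    empty.\<close>
  have "I \<subseteq> {2..Max (insert 0 I)}" using assms(3,4) by auto
  moreover have "I \<inter> {0<..} = I" using assms(4) by fastforce
  ultimately show ?thesis
    using prob_prefix_and_switch_pattern[OF assms(1,2), of I "Max (insert 0 I)" 0] by simp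
qed

section \<open>Divergence survives keeping one run length per starting point\<close>

lemma sum_geometric_half_le: "(\<Sum>j=a..n. (1 / 2) ^ j) \<le> 2 * (1 / 2 :: real) ^ a"
proof (cases "a \<le> n")
  case True
  then have "(\<Sum>j=a..n. (1 / 2 :: real) ^ j) = 2 * (1 / 2) ^ a - (1 / 2) ^ n"
    by (induction n rule: dec_induct) simp_all
  then show ?thesis by simp
qed simp

text \<open>Here \<open>s = N - k N\<close>, and \<open>LEAST j. k (s + j) = j\<close> is the smallest \<open>k N\<close> among the \<open>N\<close> with
  this \<open>s\<close>.\<close>

lemma not_summable_least_run_length:
  fixes k :: "nat \<Rightarrow> nat"
  assumes div: "\<not> summable (\<lambda>n. (1 / 2 :: real) ^ k n)"
  defines "T \<equiv> {s. 2 \<le> s \<and> (\<exists>j. k (s + j) = j)}"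
  shows "\<not> summable (\<lambda>s. if s \<in> T then (1 / 2 :: real) ^ Suc (LEAST j. k (s + j) = j) else 0)"
proof
  define \<kappa> where "\<kappa> s = (LEAST j. k (s + j) = j)" for s
  let ?g = "\<lambda>s. if s \<in> T then (1 / 2 :: real) ^ Suc (\<kappa> s) else 0"
  assume "summable (\<lambda>s. if s \<in> T then (1 / 2 :: real) ^ Suc (LEAST j. k (s + j) = j) else 0)"
  then have summ: "summable ?g" unfolding \<kappa>_def .
  have "summable (\<lambda>n. (1 / 2 :: real) ^ k n)"
  proof (rule bounded_imp_summable)
    fix n
    \<comment> \<open>\<open>?G\<close> collects the indices with \<open>N - k N\<close> at least 2,
      which give starting points in \<open>T\<close>. On \<open>?B\<close> one has
      \<open>N \<le> Suc (k N)\<close>, so a geometric series bounds its share by 4 uniformly in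
      \<open>n\<close>.\<close>
    let ?G = "{N \<in> {..n}. k N + 2 \<le> N}" and ?B = "{N \<in> {..n}. N < k N + 2}"
    have "(\<Sum>N\<in>?B. (1 / 2 :: real) ^ k N) \<le> (\<Sum>N\<in>?B. 2 * (1 / 2) ^ N)"
    proof (rule sum_mono)
      fix N assume "N \<in> ?B"
      then have "(1 / 2 :: real) ^ Suc (k N) \<le> (1 / 2) ^ N" by (intro power_decreasing) auto
      then show "(1 / 2 :: real) ^ k N \<le> 2 * (1 / 2) ^ N" by simp
    qed
    also have "\<dots> \<le> (\<Sum>N=0..n. 2 * (1 / 2) ^ N)" by (intro sum_mono2) auto
    also have "\<dots> = 2 * (\<Sum>N=0..n. (1 / 2) ^ N)" by (simp add: sum_distrib_left)
    also have "\<dots> \<le> 4" using sum_geometric_half_le[of 0 n] by simp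
    finally have B: "(\<Sum>N\<in>?B. (1 / 2 :: real) ^ k N) \<le> 4" .
    have "inj_on (\<lambda>N. (N - k N, k N)) ?G" by (rule inj_onI) auto
    then have "(\<Sum>N\<in>?G. (1 / 2 :: real) ^ k N)
        = (\<Sum>(s, j)\<in>(\<lambda>N. (N - k N, k N)) ` ?G. (1 / 2) ^ j)"
      by (simp add: sum.reindex)
    also have "\<dots> \<le> (\<Sum>(s, j)\<in>(SIGMA s:T \<inter> {..n}. {\<kappa> s..n}). (1 / 2) ^ j)"
    proof (rule sum_mono2)
      show "(\<lambda>N. (N - k N, k N)) ` ?G \<subseteq> (SIGMA s:T \<inter> {..n}. {\<kappa> s..n})"
      proof (rule image_subsetI)
        fix N assume N: "N \<in> ?G"
        then have *: "k (N - k N + k N) = k N" and "2 \<le> N - k N" by auto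
        then have "N - k N \<in> T" unfolding T_def by blast
        moreover from * have "\<kappa> (N - k N) \<le> k N" unfolding \<kappa>_def by (rule Least_le)
        ultimately show "(N - k N, k N) \<in> (SIGMA s:T \<inter> {..n}. {\<kappa> s..n})" using N by auto
      qed
    qed auto
    also have "\<dots> = (\<Sum>s\<in>T \<inter> {..n}. \<Sum>j=\<kappa> s..n. (1 / 2) ^ j)"
      by (subst sum.Sigma) auto
    \<comment> \<open>The factor 4 is 2 from the geometric series times 2 for the \<open>Suc\<close>
      in the exponent of \<open>?g\<close>, which pays for the non-switch at
      \<open>s\<close>.\<close>
    also have "\<dots> \<le> (\<Sum>s\<in>T \<inter> {..n}. 4 * ?g s)"
      by (intro sum_mono) (use sum_geometric_half_le in auto)
    also have "\<dots> \<le> (\<Sum>s\<le>n. 4 * ?g s)" by (intro sum_mono2) auto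
    also have "\<dots> = 4 * (\<Sum>s\<le>n. ?g s)" by (simp add: sum_distrib_left)
    also have "\<dots> \<le> 4 * suminf ?g"
      by (intro mult_left_mono sum_le_suminf[OF summ]) auto
    finally have "(\<Sum>N\<in>?G. (1 / 2 :: real) ^ k N) \<le> 4 * suminf ?g" .
    moreover have "(\<Sum>N\<le>n. (1 / 2 :: real) ^ k N) = (\<Sum>N\<in>?G \<union> ?B. (1 / 2) ^ k N)"
      by (intro sum.cong) auto
    moreover have "\<dots> = (\<Sum>N\<in>?G. (1 / 2) ^ k N) + (\<Sum>N\<in>?B. (1 / 2) ^ k N)"
      by (intro sum.union_disjoint) auto
    ultimately show "(\<Sum>N\<le>n. (1 / 2 :: real) ^ k N) \<le> 4 * suminf ?g + 4" using B by linarith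
  qed simp
  with div show False by simp
qed

section \<open>Almost sure recurrence of long enough runs\<close>

text \<open>The condition \<open>k N < N\<close> places the start \<open>N - k N\<close> of the
  block at index 1 or later, so only bits with positive index are compared.\<close>

lemma (in prob_space) AE_infinitely_many_switch_runs:
  fixes Z :: "nat \<Rightarrow> 'a \<Rightarrow> bool" and k :: "nat \<Rightarrow> nat"
  assumes ind: "indep_vars (\<lambda>_. count_space UNIV) Z {1..}"
    and half: "\<And>i. i \<ge> 1 \<Longrightarrow> prob {\<omega> \<in> space M. Z i \<omega>} = 1 / 2"
    and div: "\<not> summable (\<lambda>n. (1 / 2 :: real) ^ k n)"
  shows "AE \<omega> in M. \<exists>\<^sub>\<infinity>N. k N < N \<and> (\<forall>i\<in>{N - k N<..N}. Z (i - 1) \<omega> \<noteq> Z i \<omega>)"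
proof -
  define T where "T = {s. 2 \<le> s \<and> (\<exists>j. k (s + j) = j)}"
  define \<kappa> where "\<kappa> s = (LEAST j. k (s + j) = j)" for s
  have \<kappa>: "k (s + \<kappa> s) = \<kappa> s" if "s \<in> T" for s
    using that LeastI_ex[of "\<lambda>j. k (s + j) = j"] by (auto simp: T_def \<kappa>_def)
  \<comment> \<open>A non-switch at \<open>s\<close> followed by \<open>\<kappa> s\<close> switches.
    Since \<open>2 \<le> s\<close> on \<open>T\<close>, the comparison at \<open>s\<close> involves
    bits of positive index.\<close>
  define B where "B s = (if s \<in> T then {\<omega> \<in> space M. \<forall>i\<in>{s..s + \<kappa> s}.
    (Z (i - 1) \<omega> \<noteq> Z i \<omega>) = (i \<noteq> s)} else {})" for s
  have Z[measurable]: "Z i \<in> measurable M (count_space UNIV)" if "i \<ge> 1" for i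
    using ind that by (auto simp: indep_vars_def)
  have ev: "B s \<in> events" for s
  proof (cases "s \<in> T")
    case True
    then have "{s..s + \<kappa> s} \<subseteq> {2..}" by (auto simp: T_def)
    from switch_pattern_in_events[OF Z _ this] True show ?thesis by (simp add: B_def)
  qed (simp add: B_def)
  have prB: "prob (B s) = (if s \<in> T then (1 / 2) ^ Suc (\<kappa> s) else 0)" for s
  proof (cases "s \<in> T")
    case True
    then have "{s..s + \<kappa> s} \<subseteq> {2..}" by (auto simp: T_def)
    from prob_switch_pattern[OF ind half _ this, of "\<lambda>i. i \<noteq> s"] True
    show ?thesis by (simp add: B_def)
  qed (simp add: B_def)
  have corr: "prob (B s \<inter> B t) \<le> prob (B s) * prob (B t)" if "s < t" for s t
  proof (cases "s \<in> T \<and> t \<in> T")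
    case True
    show ?thesis
    proof (cases "t \<le> s + \<kappa> s")
      case le: True
      \<comment> \<open>Here \<open>t\<close> lies inside the run required by \<open>B s\<close>, so
        it must be a switch, whereas \<open>B t\<close> requires a non-switch there.\<close>
      have "B s \<inter> B t = {}"
      proof (rule ccontr)
        assume "B s \<inter> B t \<noteq> {}"
        then obtain \<omega> where "\<omega> \<in> B s" "\<omega> \<in> B t" by blast
        with True have "\<forall>i\<in>{s..s + \<kappa> s}. (Z (i - 1) \<omega> \<noteq> Z i \<omega>) = (i \<noteq> s)"
          and "\<forall>i\<in>{t..t + \<kappa> t}. (Z (i - 1) \<omega> \<noteq> Z i \<omega>) = (i \<noteq> t)" by (auto simp: B_def)
        from bspec[OF this(1), of t] bspec[OF this(2), of t] le \<open>s < t\<close> show False by auto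
      qed
      then show ?thesis by simp
    next
      case gt: False
      let ?I = "{s..s + \<kappa> s} \<union> {t..t + \<kappa> t}"
      \<comment> \<open>The index ranges are disjoint, so one pattern describes both events and the
        joint probability factorizes.\<close>
      let ?y = "\<lambda>i. i \<noteq> s \<and> i \<noteq> t"
      have y: "i \<in> {s..s + \<kappa> s} \<Longrightarrow> (i \<noteq> s) = ?y i"
        "i \<in> {t..t + \<kappa> t} \<Longrightarrow> (i \<noteq> t) = ?y i" for i
        using gt \<open>s < t\<close> by auto
      have "B s = {\<omega> \<in> space M. \<forall>i\<in>{s..s + \<kappa> s}. (Z (i - 1) \<omega> \<noteq> Z i \<omega>) = ?y i}"
        unfolding B_def if_P[OF conjunct1[OF True]]
        by (intro Collect_cong conj_cong ball_cong refl) (rule arg_cong2[where f = "(=)", OF refl y(1)])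
      moreover have "B t = {\<omega> \<in> space M. \<forall>i\<in>{t..t + \<kappa> t}. (Z (i - 1) \<omega> \<noteq> Z i \<omega>) = ?y i}"
        unfolding B_def if_P[OF conjunct2[OF True]]
        by (intro Collect_cong conj_cong ball_cong refl) (rule arg_cong2[where f = "(=)", OF refl y(2)])
      ultimately have "B s \<inter> B t = {\<omega> \<in> space M. \<forall>i\<in>?I. (Z (i - 1) \<omega> \<noteq> Z i \<omega>) = ?y i}"
        by blast
      moreover have "?I \<subseteq> {2..}" using True by (auto simp: T_def)
      moreover have "card ?I = Suc (\<kappa> s) + Suc (\<kappa> t)"
        using gt by (subst card_Un_disjoint) auto
      ultimately have "prob (B s \<inter> B t) = (1 / 2) ^ (Suc (\<kappa> s) + Suc (\<kappa> t))"
        using prob_switch_pattern[OF ind half, of ?I ?y] by simp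
      also have "\<dots> = prob (B s) * prob (B t)"
        using True by (simp add: prB power_add)
      finally show ?thesis by simp
    qed
  qed (auto simp: B_def)
  have "AE \<omega> in M. \<exists>\<^sub>\<infinity>s. \<omega> \<in> B s"
  proof (rule borel_cantelli_nonpos_correlated)
    show "prob (B i \<inter> B j) \<le> prob (B i) * prob (B j)" if "i \<noteq> j" for i j
      using that corr[of i j] corr[of j i] by (cases "i < j") (auto simp: Int_commute mult.commute)
    show "\<not> summable (\<lambda>s. prob (B s))"
      unfolding prB T_def \<kappa>_def using not_summable_least_run_length[OF div] .
  qed (rule ev)
  then show ?thesis
  proof eventually_elim
    case (elim \<omega>)
    show ?case
      unfolding INFM_nat_le
    proof
      fix m
      obtain s where s: "s \<ge> m" "\<omega> \<in> B s" using elim by (auto simp: INFM_nat_le)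
      then have T: "s \<in> T" by (auto simp: B_def split: if_splits)
      then have "2 \<le> s" by (simp add: T_def)
      have "Z (i - 1) \<omega> \<noteq> Z i \<omega>" if "i \<in> {s<..s + \<kappa> s}" for i
        using s(2) T that by (auto simp: B_def)
      \<comment> \<open>The witness \<open>N = s + \<kappa> s\<close> satisfies
        \<open>k N = \<kappa> s\<close>, hence \<open>N - k N = s\<close>, and it is at least
        \<open>m\<close> because \<open>s\<close> is.\<close>
      with s(1) \<open>2 \<le> s\<close> show "\<exists>N\<ge>m. k N < N \<and> (\<forall>i\<in>{N - k N<..N}. Z (i - 1) \<omega> \<noteq> Z i \<omega>)"
        by (intro exI[of _ "s + \<kappa> s"]) (simp add: \<kappa>[OF T])
    qed
  qed
qed

section \<open>From runs of switches to \<open>longest_run\<close>\<close>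

text \<open>For bits, the two summands are the indicators of an upward and of a downward switch, so
  exactly one of them is 1 at each of the \<open>l\<close> indices.\<close>

lemma switch_count_all_switches:
  assumes bit: "\<And>i. i \<ge> 1 \<Longrightarrow> X i \<omega> = 0 \<or> X i \<omega> = 1" and "m \<ge> 1"
    and "\<And>i. i \<in> {m<..m + l} \<Longrightarrow> (X (i - 1) \<omega> = 1) \<noteq> (X i \<omega> = 1)"
  shows "switch_count X m (Suc l) \<omega> = real l"
proof -
  have "switch_count X m (Suc l) \<omega>
      = (\<Sum>i = m + 1..l + m. (1 - X (i - 1) \<omega>) * X i \<omega> + X (i - 1) \<omega> * (1 - X i \<omega>))"
    by (simp add: switch_count_def sum.distrib)
  also have "\<dots> = (\<Sum>i = m + 1..l + m. 1)"
  proof (rule sum.cong[OF refl])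
    fix i assume i: "i \<in> {m + 1..l + m}"
    then have "X (i - 1) \<omega> = 0 \<or> X (i - 1) \<omega> = 1" "X i \<omega> = 0 \<or> X i \<omega> = 1"
      using \<open>m \<ge> 1\<close> bit[of "i - 1"] bit[of i] by auto
    with assms(3)[of i] i
    show "(1 - X (i - 1) \<omega>) * X i \<omega> + X (i - 1) \<omega> * (1 - X i \<omega>) = 1" by auto
  qed
  finally show ?thesis by simp
qed

lemma le_longest_run:
  assumes "\<omega> \<in> space P" and "1 \<le> i" and "i \<le> m" and "m + l \<le> i + N - 1"
    and "switch_count X m (Suc l) \<omega> = real l"
  shows "l \<le> longest_run P X i N \<omega>"
  unfolding longest_run_def
proof (rule Max_ge)
  show "finite {n - 1 |n. 1 \<le> n \<and> n \<le> N \<and> \<omega> \<in> run_event P X n i N}"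
    by (rule finite_subset[of _ "(\<lambda>n. n - 1) ` {..N}"]) auto
  \<comment> \<open>A block of \<open>Suc l\<close> terms carries \<open>l\<close> switches. With
    \<open>1 \<le> i \<le> m\<close>, the bound on \<open>m + l\<close> also gives
    \<open>Suc l \<le> N\<close>.\<close>
  have "\<omega> \<in> run_event P X (Suc l) i N"
    using assms by (auto simp: run_event_def intro!: bexI[of _ m])
  with assms show "l \<in> {n - 1 |n. 1 \<le> n \<and> n \<le> N \<and> \<omega> \<in> run_event P X n i N}"
    by (auto intro!: exI[of _ "Suc l"])
qed

theorem theorem3p4:
  fixes P :: "'a measure"
    and X :: "nat \<Rightarrow> 'a \<Rightarrow> real"
    and \<gamma> :: "nat \<Rightarrow> real"
  assumes "prob_space P"
    and "prob_space.indep_vars P (\<lambda>_. borel) X {1..}"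
    and "\<And>i. i \<ge> 1 \<Longrightarrow> distr P borel (X i) = distr P borel (X 1)"
    and "measure P {\<omega> \<in> space P. X 1 \<omega> = 0} = 1 / 2"
    and "measure P {\<omega> \<in> space P. X 1 \<omega> = 1} = 1 / 2"
    and "\<And>n. n \<ge> 1 \<Longrightarrow> \<gamma> n > 0"
    and "\<not> summable (\<lambda>n. 2 powr (- \<gamma> (Suc n)))"
  shows "AE \<omega> in P. \<exists>Ns :: nat \<Rightarrow> nat. inj_on Ns {1..} \<and>
           (\<forall>i\<ge>1. Ns i \<ge> 1 \<and> real (longest_run P X 1 (Ns i) \<omega>) \<ge> \<gamma> (Ns i) - 1)"
proof -
  interpret prob_space P by fact
  have X[measurable]: "X i \<in> borel_measurable P" if "i \<ge> 1" for i
    using assms(2) that by (auto simp: indep_vars_def)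
  have law: "prob {\<omega> \<in> space P. X i \<omega> \<in> A} = prob {\<omega> \<in> space P. X 1 \<omega> \<in> A}"
    if "i \<ge> 1" "A \<in> sets borel" for i A
  proof -
    have "measure (distr P borel (X i)) A = measure (distr P borel (X 1)) A"
      using assms(3)[OF that(1)] by simp
    moreover have "{\<omega> \<in> space P. X j \<omega> \<in> A} = X j -` A \<inter> space P" for j by auto
    ultimately show ?thesis using that by (simp add: measure_distr)
  qed
  \<comment> \<open>The \<open>X i\<close> are real-valued and equal 0 or 1 only almost surely; one
    null set serves all \<open>i\<close>.\<close>
  have bits: "AE \<omega> in P. \<forall>i\<ge>1. X i \<omega> = 0 \<or> X i \<omega> = 1"
    unfolding AE_all_countable
  proof (intro allI impI)
    fix i
    have "AE \<omega> in P. X i \<omega> = 0 \<or> X i \<omega> = 1" if "i \<ge> 1"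
    proof -
      have "prob {\<omega> \<in> space P. X 1 \<omega> \<in> {0, 1}}
          = prob ({\<omega> \<in> space P. X 1 \<omega> = 0} \<union> {\<omega> \<in> space P. X 1 \<omega> = 1})"
        by (intro arg_cong[of _ _ prob]) auto
      also have "\<dots> = 1"
        using assms(4,5) by (subst finite_measure_Union) auto
      finally have "prob {\<omega> \<in> space P. X i \<omega> \<in> {0, 1}} = 1"
        using law[OF that, of "{0, 1}"] by simp
      from AE_prob_1[OF this] show ?thesis by eventually_elim auto
    qed
    then show "AE \<omega> in P. i \<ge> 1 \<longrightarrow> X i \<omega> = 0 \<or> X i \<omega> = 1" by (cases "i \<ge> 1") auto
  qed
  define Z where "Z i \<omega> = (X i \<omega> = 1)" for i \<omega>
  have ind: "indep_vars (\<lambda>_. count_space UNIV) Z {1..}"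
    unfolding Z_def by (rule indep_vars_compose2[OF assms(2)]) measurable
  have half: "prob {\<omega> \<in> space P. Z i \<omega>} = 1 / 2" if "i \<ge> 1" for i
    using law[OF that, of "{1}"] assms(5) by (simp add: Z_def)
  \<comment> \<open>The least natural number that is at least \<open>\<gamma> n - 1\<close>.\<close>
  define k where "k n = nat \<lceil>\<gamma> n - 1\<rceil>" for n
  have div: "\<not> summable (\<lambda>n. (1 / 2 :: real) ^ k n)"
  proof
    assume "summable (\<lambda>n. (1 / 2 :: real) ^ k n)"
    \<comment> \<open>The shift discards index 0, where nothing is assumed about
      \<open>\<gamma>\<close>.\<close>
    then have "summable (\<lambda>n. (1 / 2 :: real) ^ k (Suc n))" by (subst summable_Suc_iff)
    then have "summable (\<lambda>n. 2 powr (- \<gamma> (Suc n)))"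
    proof (rule summable_comparison_test')
      fix n
      \<comment> \<open>Rounding up adds less than 1; where \<open>nat\<close> cuts off at 0,
        positivity of \<open>\<gamma>\<close> gives the bound.\<close>
      have "real (k (Suc n)) \<le> \<gamma> (Suc n)"
        using assms(6)[of "Suc n"] unfolding k_def by linarith
      then have "2 powr (- \<gamma> (Suc n)) \<le> 2 powr (- real (k (Suc n)))" by simp
      then show "norm (2 powr (- \<gamma> (Suc n))) \<le> (1 / 2) ^ k (Suc n)"
        by (simp add: powr_minus powr_realpow power_one_over inverse_eq_divide)
    qed
    with assms(7) show False by simp
  qed
  have "AE \<omega> in P. \<exists>\<^sub>\<infinity>N. k N < N \<and> (\<forall>i\<in>{N - k N<..N}. Z (i - 1) \<omega> \<noteq> Z i \<omega>)"
    by (rule AE_infinitely_many_switch_runs[OF ind _ div]) (rule half)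
  with bits AE_space
  show ?thesis
  proof eventually_elim
    case (elim \<omega>)
    define S where "S = {N. k N < N \<and> (\<forall>i\<in>{N - k N<..N}. Z (i - 1) \<omega> \<noteq> Z i \<omega>)}"
    have inf: "infinite S" using elim(3) by (simp add: S_def frequently_cofinite)
    have S: "N \<ge> 1 \<and> real (longest_run P X 1 N \<omega>) \<ge> \<gamma> N - 1" if "N \<in> S" for N
    proof -
      have N: "k N < N" and sw: "\<And>i. i \<in> {N - k N<..N} \<Longrightarrow> Z (i - 1) \<omega> \<noteq> Z i \<omega>"
        using that by (auto simp: S_def)
      have "switch_count X (N - k N) (Suc (k N)) \<omega> = real (k N)"
        using elim(1) N sw by (intro switch_count_all_switches) (auto simp: Z_def)
      then have "k N \<le> longest_run P X 1 N \<omega>"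
        using N elim(2) by (intro le_longest_run[where m = "N - k N"]) auto
      moreover have "\<gamma> N - 1 \<le> real (k N)" unfolding k_def by linarith
      ultimately show ?thesis using N by linarith
    qed
    \<comment> \<open>The increasing enumeration of the infinite set \<open>S\<close> supplies the
      distinct integers; it starts at 0, and restricting to positive indices keeps it
      injective.\<close>
    have "inj_on (enumerate S) {1..}"
      using strict_mono_enumerate[OF inf] strict_mono_imp_inj_on by (metis inj_on_subset subset_UNIV)
    with S enumerate_in_set[OF inf] show ?case by blast
  qed
qed

end
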